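(* Let $R$ be a commutative ring with unity. Let $C$ be a cycle on $n$ vertices $v_1,\dots,v_n$. For each $1\le i\le n$ let $T_i$ be a tree, possibly consisting of a single vertex. Let $G_1$ be the graph formed by pasting $T_1$ to $C$ at $v_1$, and for each $2\le i\le n$ let $G_i$ be the graph formed by pasting $T_i$ to $G_{i-1}$ at $v_i$ (so $V(T_i)\cap V(G_{i-1})=\{v_i\}$). Let $\alpha$ be an edge-labeling of $G_n$ over $R$, with each $G_j$ carrying the restricted labeling. Then $(G_n,\alpha)$ satisfies the Universal Difference Property if and only if both of the following hold: (i) $G_j$ (with the restricted labeling) satisfies the Universal Difference Property for all $1\le j\le n-1$; (ii) for every $u\in V(G_{n-1})$ and $w\in V(T_n)$, $$\bigcap_{P\in\mathcal{P}(u,w)}\alpha(P)=\Big(\bigcap_{P\in\mathcal{P}(u,v_n)}\alpha(P)\Big)+\Big(\bigcap_{P\in\mathcal{P}(v_n,w)}\alpha(P)\Big),$$ where $\mathcal{P}(a,b)$ denotes the set of paths from $a$ to $b$ in $G_n$.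
   Context: An edge-labeling of a graph over $R$ assigns to each edge an ideal of $R$. A spline on $(G,\alpha)$ is a function $\rho:V(G)\to R$ with $\rho(u)-\rho(v)\in\alpha(uv)$ for every edge $uv$. A path has no repeated vertices; $\alpha(P)$ is the sum of the ideals labeling the edges of the path $P$. Pasting two graphs at a vertex $z$ means taking their union where they share only the vertex $z$. An edge-labeled graph $(G,\alpha)$ satisfies the Universal Difference Property (UDP) if for every pair of vertices $u,w$ and every $x\in\bigcap_{P}\alpha(P)$ (intersection over all paths $P$ in $G$ from $u$ to $w$) there is a spline $\rho$ on $(G,\alpha)$ with $\rho(u)-\rho(w)=x$. *)

theory Defs
  imports "HOL-Algebra.Ideal"
begin

record 'v ugraph =
  verts :: "'v set"
  edges :: "'v set set"

definition simple_graph :: "'v ugraph \<Rightarrow> bool" where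
  "simple_graph G \<longleftrightarrow>
     (\<forall>e\<in>edges G. \<exists>u v. u \<in> verts G \<and> v \<in> verts G \<and> u \<noteq> v \<and> e = {u, v})"

definition subgraph :: "'v ugraph \<Rightarrow> 'v ugraph \<Rightarrow> bool" where
  "subgraph H G \<longleftrightarrow> verts H \<subseteq> verts G \<and> edges H \<subseteq> edges G"

text \<open>A path is the list of its vertices; a one-element list is the trivial path
  from a vertex to itself.\<close>

definition paths :: "'v ugraph \<Rightarrow> 'v \<Rightarrow> 'v \<Rightarrow> 'v list set" where
  "paths G u w =
     {p. p \<noteq> [] \<and> hd p = u \<and> last p = w \<and> distinct p \<and> set p \<subseteq> verts G \<and>
         (\<forall>i. Suc i < length p \<longrightarrow> {p ! i, p ! Suc i} \<in> edges G)}"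

definition connected_graph :: "'v ugraph \<Rightarrow> bool" where
  "connected_graph G \<longleftrightarrow>
     verts G \<noteq> {} \<and> (\<forall>u\<in>verts G. \<forall>w\<in>verts G. paths G u w \<noteq> {})"

definition cycle_graph :: "'v ugraph \<Rightarrow> bool" where
  "cycle_graph C \<longleftrightarrow>
     (\<exists>c. distinct c \<and> length c \<ge> 3 \<and> verts C = set c \<and>
          edges C = {{c ! i, c ! (Suc i mod length c)} | i. i < length c})"

definition tree :: "'v ugraph \<Rightarrow> bool" where
  "tree T \<longleftrightarrow> simple_graph T \<and> connected_graph T \<and> \<not> (\<exists>C. cycle_graph C \<and> subgraph C T)"

definition pasting :: "'v ugraph \<Rightarrow> 'v ugraph \<Rightarrow> 'v \<Rightarrow> 'v ugraph \<Rightarrow> bool" where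
  "pasting H T z G \<longleftrightarrow>
     verts H \<inter> verts T = {z} \<and>
     G = \<lparr>verts = verts H \<union> verts T, edges = edges H \<union> edges T\<rparr>"

text \<open>Labelings are total functions of which only the values on the edges of the graph
  matter, so the restriction of a labeling to a subgraph is the same function.\<close>

definition edge_labeling ::
    "('a, 'm) ring_scheme \<Rightarrow> 'v ugraph \<Rightarrow> ('v set \<Rightarrow> 'a set) \<Rightarrow> bool" where
  "edge_labeling R G \<alpha> \<longleftrightarrow> (\<forall>e\<in>edges G. ideal (\<alpha> e) R)"

definition spline ::
    "('a, 'm) ring_scheme \<Rightarrow> 'v ugraph \<Rightarrow> ('v set \<Rightarrow> 'a set) \<Rightarrow> ('v \<Rightarrow> 'a) \<Rightarrow> bool" where
  "spline R G \<alpha> \<rho> \<longleftrightarrow>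
     \<rho> \<in> verts G \<rightarrow> carrier R \<and>
     (\<forall>u v. {u, v} \<in> edges G \<longrightarrow> \<rho> u \<ominus>\<^bsub>R\<^esub> \<rho> v \<in> \<alpha> {u, v})"

fun path_label ::
    "('a, 'm) ring_scheme \<Rightarrow> ('v set \<Rightarrow> 'a set) \<Rightarrow> 'v list \<Rightarrow> 'a set" where
  "path_label R \<alpha> (u # v # p) = \<alpha> {u, v} <+>\<^bsub>R\<^esub> path_label R \<alpha> (v # p)"
| "path_label R \<alpha> _ = {\<zero>\<^bsub>R\<^esub>}"

text \<open>The intersection is taken inside \<open>carrier R\<close>, so that it is the whole ring if there is
  no path between the two vertices.\<close>

definition path_inter ::
    "('a, 'm) ring_scheme \<Rightarrow> 'v ugraph \<Rightarrow> ('v set \<Rightarrow> 'a set) \<Rightarrow> 'v \<Rightarrow> 'v \<Rightarrow> 'a set" where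
  "path_inter R G \<alpha> u w = carrier R \<inter> (\<Inter>p\<in>paths G u w. path_label R \<alpha> p)"

definition UDP ::
    "('a, 'm) ring_scheme \<Rightarrow> 'v ugraph \<Rightarrow> ('v set \<Rightarrow> 'a set) \<Rightarrow> bool" where
  "UDP R G \<alpha> \<longleftrightarrow>
     (\<forall>u\<in>verts G. \<forall>w\<in>verts G. \<forall>x\<in>path_inter R G \<alpha> u w.
        \<exists>\<rho>. spline R G \<alpha> \<rho> \<and> \<rho> u \<ominus>\<^bsub>R\<^esub> \<rho> w = x)"

end

theory Submission imports Defs begin

text \<open>
  When a tree \<open>T\<close> is pasted to \<open>H\<close> at \<open>z\<close>, a path between vertices of one part stays in that part,
  and a path from \<open>H\<close> to \<open>T\<close> is a path in \<open>H\<close> ending in \<open>z\<close> followed by a path in \<open>T\<close>. Splines on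
  \<open>G\<close> restrict to \<open>H\<close>, and \<open>\<rho> u - \<rho> w = (\<rho> u - \<rho> z) + (\<rho> z - \<rho> w)\<close>, where each difference
  lies in the respective intersection of path ideals; this gives the two conditions. Conversely,
  splines on \<open>H\<close> and \<open>T\<close> glue after shifting one of them by a constant. Trees always have the
  Universal Difference Property: given an edge \<open>uv\<close> and \<open>a \<in> \<alpha>(uv)\<close>, the function that is \<open>a\<close>
  on the component of \<open>u\<close> in \<open>T - uv\<close> and \<open>0\<close> elsewhere is a spline, and sums of
  such functions along a path realise every element of the ideal of the path.
\<close>

section \<open>Paths\<close>

lemma in_paths_iff:
  "p \<in> paths G u w \<longleftrightarrow>
     p \<noteq> [] \<and> hd p = u \<and> last p = w \<and> distinct p \<and> set p \<subseteq> verts G \<and>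
     successively (\<lambda>x y. {x, y} \<in> edges G) p"
  by (simp add: paths_def successively_conv_nth)

lemma rev_in_paths: "p \<in> paths G u w \<Longrightarrow> rev p \<in> paths G w u"
  by (auto simp: in_paths_iff hd_rev last_rev insert_commute)

section \<open>Paths in a pasted graph\<close>

lemma pasting_commute: "pasting H T z G \<longleftrightarrow> pasting T H z G"
  by (auto simp: pasting_def)

lemma pasting_verts: "pasting H T z G \<Longrightarrow> verts G = verts H \<union> verts T"
  by (simp add: pasting_def)

lemma pasting_edges: "pasting H T z G \<Longrightarrow> edges G = edges H \<union> edges T"
  by (simp add: pasting_def)

lemma pasting_Int_verts: "pasting H T z G \<Longrightarrow> verts H \<inter> verts T = {z}"
  by (simp add: pasting_def)

lemma pasting_vertex:
  assumes "pasting H T z G"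
  shows "z \<in> verts H" "z \<in> verts T"
  using pasting_Int_verts[OF assms] by auto

text \<open>A vertex of \<open>H\<close> other than \<open>z\<close> is not in \<open>T\<close>, so
  an edge leaving it must belong to \<open>H\<close> and leads to \<open>H\<close> again. With
  \<open>butlast\<close>, the walk may end in \<open>z\<close>, so the lemma applies to a path cut
  off at \<open>z\<close>.\<close>

lemma walk_stays_until_pasting_vertex:
  assumes "pasting H T z G" "\<Union>(edges H) \<subseteq> verts H" "\<Union>(edges T) \<subseteq> verts T"
    and "successively (\<lambda>x y. {x, y} \<in> edges G) p" "p \<noteq> []" "hd p \<in> verts H" "z \<notin> set (butlast p)"
  shows "successively (\<lambda>x y. {x, y} \<in> edges H) p \<and> set p \<subseteq> verts H"
  using assms(4-7)
proof (induction p rule: induct_list012)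
  case (3 x y p)
  have prems: "{x, y} \<in> edges G" "successively (\<lambda>x y. {x, y} \<in> edges G) (y # p)"
    "x \<in> verts H" "x \<noteq> z" "z \<notin> set (butlast (y # p))"
    using "3.prems" by (auto split: if_splits)
  have "x \<notin> verts T"
    using prems(3,4) pasting_Int_verts[OF assms(1)] by blast
  hence e: "{x, y} \<in> edges H"
    using prems(1) assms(3) pasting_edges[OF assms(1)] by blast
  hence "y \<in> verts H"
    using assms(2) by blast
  thus ?case
    using "3.IH"(2) prems e by simp
qed auto

text \<open>A path meets \<open>z\<close> only once, so each half touches \<open>z\<close> only at
  the cut and cannot change sides. The second pasting names the side of the endpoint
  \<open>w\<close>: \<open>K\<close> is \<open>H\<close> for a path that returns to
  \<open>H\<close>, and \<open>T\<close> for one that crosses over.\<close>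

lemma pasting_path_split:
  assumes "pasting H T z G" "\<Union>(edges H) \<subseteq> verts H" "\<Union>(edges T) \<subseteq> verts T"
    and "pasting K L z G" "\<Union>(edges K) \<subseteq> verts K" "\<Union>(edges L) \<subseteq> verts L"
    and "p @ z # q \<in> paths G u w" "u \<in> verts H" "w \<in> verts K"
  shows "p @ [z] \<in> paths H u z" "z # q \<in> paths K z w"
proof -
  note pq = assms(7)[unfolded in_paths_iff]
  have "successively (\<lambda>x y. {x, y} \<in> edges H) (p @ [z]) \<and> set (p @ [z]) \<subseteq> verts H"
    using pq assms(8)
    by (intro walk_stays_until_pasting_vertex[OF assms(1-3)])
       (auto simp: successively_append_iff hd_append split: if_splits)
  thus "p @ [z] \<in> paths H u z"
    using pq by (auto simp: in_paths_iff hd_append split: if_splits)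
  \<comment> \<open>The second half is walked backwards from \<open>w\<close>, so that it starts in
    \<open>K\<close> and has \<open>z\<close> as its last vertex.\<close>
  have "successively (\<lambda>x y. {x, y} \<in> edges K) (rev (z # q)) \<and> set (rev (z # q)) \<subseteq> verts K"
  proof (rule walk_stays_until_pasting_vertex[OF assms(4-6)])
    show "successively (\<lambda>x y. {x, y} \<in> edges G) (rev (z # q))"
      using pq unfolding successively_rev by (auto simp: successively_append_iff insert_commute)
    show "hd (rev (z # q)) \<in> verts K"
      using pq assms(9) unfolding hd_rev by auto
    show "z \<notin> set (butlast (rev (z # q)))"
      using pq by auto
  qed auto
  thus "z # q \<in> paths K z w"
    using pq unfolding successively_rev by (auto simp: in_paths_iff insert_commute)
qed

text \<open>Leaving \<open>H\<close> means passing through \<open>z\<close>, and coming back would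
  visit \<open>z\<close> again, which a path cannot do.\<close>

lemma pasting_paths_eq:
  assumes "pasting H T z G" "\<Union>(edges H) \<subseteq> verts H" "\<Union>(edges T) \<subseteq> verts T"
    and "u \<in> verts H" "w \<in> verts H"
  shows "paths G u w = paths H u w"
proof (intro equalityI subsetI)
  fix p assume p: "p \<in> paths G u w"
  show "p \<in> paths H u w"
  proof (cases "z \<in> set p")
    case True
    then obtain p1 p2 where eq: "p = p1 @ z # p2"
      by (meson split_list)
    note parts = pasting_path_split[OF assms(1-3) assms(1-3) p[unfolded eq] assms(4,5)]
    show ?thesis
      using parts p unfolding eq in_paths_iff successively_append_iff by (auto split: if_splits)
  next
    case False
    with p assms(4) show ?thesis
      using walk_stays_until_pasting_vertex[OF assms(1-3), of p]
      by (auto simp: in_paths_iff dest: in_set_butlastD)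
  qed
next
  fix p assume "p \<in> paths H u w"
  thus "p \<in> paths G u w"
    using pasting_verts[OF assms(1)] pasting_edges[OF assms(1)]
    by (auto simp: in_paths_iff elim!: successively_mono)
qed

text \<open>A path avoiding \<open>z\<close> would stay in \<open>H\<close>, so its end
  \<open>w\<close> would lie in both parts and be \<open>z\<close> itself. Hence \<open>z\<close> is
  on the path, and the path is cut there.\<close>

lemma pasting_path_crosses:
  assumes "pasting H T z G" "\<Union>(edges H) \<subseteq> verts H" "\<Union>(edges T) \<subseteq> verts T"
    and "p \<in> paths G u w" "u \<in> verts H" "w \<in> verts T"
  obtains p1 p2 where "p = p1 @ z # p2" "p1 @ [z] \<in> paths H u z" "z # p2 \<in> paths T z w"
proof -
  have "z \<in> set p"
  proof (rule ccontr)
    assume "z \<notin> set p"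
    hence "w \<in> verts H"
      using walk_stays_until_pasting_vertex[OF assms(1-3), of p] assms(4,5) last_in_set[of p]
      by (auto simp: in_paths_iff dest: in_set_butlastD)
    hence "w = z"
      using assms(6) pasting_Int_verts[OF assms(1)] by auto
    thus False
      using \<open>z \<notin> set p\<close> assms(4) by (auto simp: in_paths_iff)
  qed
  then obtain p1 p2 where eq: "p = p1 @ z # p2"
    by (meson split_list)
  note T = assms(1)[unfolded pasting_commute[of H]]
  show ?thesis
    using pasting_path_split[OF assms(1-3) T assms(3,2) assms(4)[unfolded eq] assms(5,6)] eq that
    by blast
qed

lemma pasting_path_inter_eq:
  assumes "pasting H T z G" "\<Union>(edges H) \<subseteq> verts H" "\<Union>(edges T) \<subseteq> verts T"
    and "u \<in> verts H" "w \<in> verts H"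
  shows "path_inter R G \<alpha> u w = path_inter R H \<alpha> u w"
  using pasting_paths_eq[OF assms] by (simp add: path_inter_def)

section \<open>Edges and reachability in trees\<close>

text \<open>A path from \<open>u\<close> to \<open>v\<close> that avoids the edge between them would
  close up with that edge to a cycle.\<close>

lemma tree_edge_is_bridge:
  assumes "tree T" "{u, v} \<in> edges T"
  shows "paths (T\<lparr>edges := edges T - {{u, v}}\<rparr>) u v = {}"
proof (rule ccontr)
  assume "paths (T\<lparr>edges := edges T - {{u, v}}\<rparr>) u v \<noteq> {}"
  then obtain p where "p \<in> paths (T\<lparr>edges := edges T - {{u, v}}\<rparr>) u v"
    by blast
  hence p: "p \<noteq> []" "hd p = u" "last p = v" "distinct p" "set p \<subseteq> verts T"
    "\<And>i. Suc i < length p \<Longrightarrow> {p ! i, p ! Suc i} \<in> edges T - {{u, v}}"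
    by (auto simp: paths_def)
  have "u \<noteq> v"
    using assms unfolding tree_def simple_graph_def by fastforce
  \<comment> \<open>One vertex would force \<open>u = v\<close>, and a path on two vertices would
    use the deleted edge.\<close>
  have len: "length p \<ge> 3"
  proof (rule ccontr)
    assume "\<not> length p \<ge> 3"
    then consider x where "p = [x]" | x y where "p = [x, y]"
      using p(1) by (cases p rule: remdups_adj.cases) (auto simp: not_le less_Suc_eq)
    thus False
      using p(2,3) p(6)[of 0] \<open>u \<noteq> v\<close> by cases auto
  qed
  define C where "C = \<lparr>verts = set p, edges = {{p ! i, p ! (Suc i mod length p)} | i. i < length p}\<rparr>"
  have "{p ! i, p ! (Suc i mod length p)} \<in> edges T" if "i < length p" for i
  proof (cases "Suc i < length p")
    case True
    thus ?thesis using p(6)[of i] by simp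
  next
    \<comment> \<open>At the last index the successor wraps around to 0, which yields the closing
      edge from \<open>v\<close> back to \<open>u\<close>.\<close>
    case False
    hence i: "Suc i = length p" using that by simp
    hence "i = length p - 1" by simp
    hence "p ! i = v" "p ! 0 = u"
      using p(1-3) by (simp_all add: last_conv_nth hd_conv_nth)
    thus ?thesis
      using i assms(2) by (simp add: insert_commute)
  qed
  hence "subgraph C T"
    using p(5) by (auto simp: subgraph_def C_def)
  moreover have "cycle_graph C"
    unfolding cycle_graph_def using p(4) len by (intro exI[of _ p]) (simp add: C_def)
  ultimately show False
    using assms(1) by (auto simp: tree_def)
qed

text \<open>Makes reachability closed under edges although paths must have distinct vertices: if
  \<open>y\<close> already occurs on the path, the path is cut off there instead of being
  prolonged.\<close>

lemma paths_extend_edge: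
  assumes "paths G u x \<noteq> {}" "{x, y} \<in> edges G" "y \<in> verts G"
  shows "paths G u y \<noteq> {}"
proof -
  obtain p where p: "p \<in> paths G u x"
    using assms(1) by blast
  show ?thesis
  proof (cases "y \<in> set p")
    case True
    then obtain p1 p2 where "p = p1 @ y # p2"
      by (meson split_list)
    hence "p1 @ [y] \<in> paths G u y"
      using p by (auto simp: in_paths_iff successively_append_iff hd_append split: if_splits)
    thus ?thesis by blast
  next
    case False
    hence "p @ [y] \<in> paths G u y"
      using p assms(2,3) by (auto simp: in_paths_iff successively_append_iff)
    thus ?thesis by blast
  qed
qed

section \<open>Ideals of paths and splines\<close>

lemma spline_subset:
  assumes "spline R G \<alpha> \<rho>" "verts H \<subseteq> verts G" "edges H \<subseteq> edges G"
  shows "spline R H \<alpha> \<rho>"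
  using assms by (auto simp: spline_def)

lemma edge_labeling_subset:
  assumes "edge_labeling R G \<alpha>" "edges H \<subseteq> edges G"
  shows "edge_labeling R H \<alpha>"
  using assms by (auto simp: edge_labeling_def)

context ring
begin

lemma set_addI: "a \<in> A \<Longrightarrow> b \<in> B \<Longrightarrow> a \<oplus> b \<in> A <+>\<^bsub>R\<^esub> B"
  by (auto simp: set_add_def')

lemma set_addE:
  assumes "x \<in> A <+>\<^bsub>R\<^esub> B"
  obtains a b where "a \<in> A" "b \<in> B" "x = a \<oplus> b"
  using assms by (auto simp: set_add_def')

lemma ideal_path_label:
  assumes "edge_labeling R G \<alpha>" "successively (\<lambda>x y. {x, y} \<in> edges G) p"
  shows "ideal (path_label R \<alpha> p) R"
  using assms(2)
proof (induction p rule: induct_list012)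
  case (3 x y p)
  thus ?case
    using assms(1) by (auto simp: edge_labeling_def intro!: add_ideals)
qed (auto intro: zeroideal)

text \<open>Induction on the first part: the summand of the first edge is split off
  \<open>a\<close>, and the sum is reassociated.\<close>

lemma path_label_append:
  assumes "edge_labeling R G \<alpha>" "successively (\<lambda>x y. {x, y} \<in> edges G) (p @ z # q)"
    and "a \<in> path_label R \<alpha> (p @ [z])" "b \<in> path_label R \<alpha> (z # q)"
  shows "a \<oplus> b \<in> path_label R \<alpha> (p @ z # q)"
  using assms(2,3)
proof (induction p arbitrary: a)
  case Nil
  have "b \<in> carrier R"
    using ideal_path_label[OF assms(1), of "z # q"] Nil assms(4)
    by (auto dest: ideal.Icarr)
  thus ?case
    using Nil assms(4) by simp
next
  case (Cons x p)
  \<comment> \<open>The vertex after \<open>x\<close>, which is \<open>z\<close> when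
    \<open>p\<close> is empty. Naming it brings both lists into the form \<open>x # y # _\<close> on
    which \<open>path_label\<close> unfolds.\<close>
  define y where "y = hd (p @ [z])"
  have hd: "hd (p @ z # q) = y"
    by (simp add: y_def hd_append)
  obtain r where r: "p @ [z] = y # r"
    by (cases "p @ [z]") (auto simp: y_def)
  obtain s where s: "p @ z # q = y # s"
    using hd by (cases "p @ z # q") auto
  have walk: "{x, y} \<in> edges G" "successively (\<lambda>x y. {x, y} \<in> edges G) (p @ z # q)"
    using Cons.prems(1) by (simp_all add: s)
  obtain c d where cd: "c \<in> \<alpha> {x, y}" "d \<in> path_label R \<alpha> (p @ [z])" "a = c \<oplus> d"
    using Cons.prems(2) r by (auto elim: set_addE)
  have "ideal (\<alpha> {x, y}) R"
    using walk assms(1) by (auto simp: edge_labeling_def)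
  hence "c \<in> carrier R"
    using cd(1) by (rule ideal.Icarr)
  moreover have "d \<in> carrier R"
    using walk(2) by (intro ideal.Icarr[OF ideal_path_label[OF assms(1)] cd(2)])
      (auto simp: successively_append_iff)
  moreover have "b \<in> carrier R"
    using walk(2) by (intro ideal.Icarr[OF ideal_path_label[OF assms(1)] assms(4)])
      (auto simp: successively_append_iff)
  ultimately have "a \<oplus> b = c \<oplus> (d \<oplus> b)"
    by (simp add: cd(3) a_assoc)
  thus ?case
    using set_addI[OF cd(1) Cons.IH[OF walk(2) cd(2)]] s by simp
qed

text \<open>Edges are unordered, so reversal only permutes the ideals that are added.\<close>

lemma path_label_rev:
  assumes "edge_labeling R G \<alpha>" "successively (\<lambda>x y. {x, y} \<in> edges G) p"
    and "a \<in> path_label R \<alpha> p"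
  shows "a \<in> path_label R \<alpha> (rev p)"
  using assms(2,3)
proof (induction p arbitrary: a rule: induct_list012)
  case (3 x y p)
  obtain c d where cd: "c \<in> \<alpha> {x, y}" "d \<in> path_label R \<alpha> (y # p)" "a = c \<oplus> d"
    using "3.prems"(2) by (auto elim: set_addE)
  have "ideal (\<alpha> {x, y}) R"
    using "3.prems"(1) assms(1) by (auto simp: edge_labeling_def)
  hence c: "c \<in> carrier R"
    using cd(1) by (rule ideal.Icarr)
  have d: "d \<in> carrier R"
    using "3.prems"(1) by (intro ideal.Icarr[OF ideal_path_label[OF assms(1)] cd(2)]) auto
  \<comment> \<open>The zero is there because the label of a one-edge path unfolds to the ideal of
    the edge plus the zero ideal.\<close>
  have "c \<oplus> \<zero> \<in> path_label R \<alpha> [y, x]"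
    using cd(1) by (auto simp: insert_commute intro!: set_addI)
  moreover have "d \<in> path_label R \<alpha> (rev p @ [y])"
    using "3.IH"(2)[OF _ cd(2)] "3.prems"(1) by simp
  moreover have "successively (\<lambda>x y. {x, y} \<in> edges G) (rev p @ y # [x])"
  proof -
    have "successively (\<lambda>x y. {x, y} \<in> edges G) (rev (x # y # p))"
      using "3.prems"(1) unfolding successively_rev by (simp add: insert_commute)
    thus ?thesis by simp
  qed
  ultimately have "d \<oplus> c \<in> path_label R \<alpha> (rev p @ y # [x])"
    using path_label_append[OF assms(1), of "rev p" y "[x]" d c] c by simp
  thus ?case
    using c d by (simp add: cd(3) a_comm)
qed auto

text \<open>Exchanges the two endpoints, so that later a pair with its first vertex in the tree
  reduces to one with its first vertex in \<open>H\<close>.\<close>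

lemma path_inter_uminus:
  assumes "edge_labeling R G \<alpha>" "x \<in> path_inter R G \<alpha> u w"
  shows "\<ominus> x \<in> path_inter R G \<alpha> w u"
  unfolding path_inter_def
proof (intro IntI INT_I)
  show "\<ominus> x \<in> carrier R"
    using assms(2) by (auto simp: path_inter_def)
  fix p assume p: "p \<in> paths G w u"
  hence "rev p \<in> paths G u w" by (rule rev_in_paths)
  hence "x \<in> path_label R \<alpha> (rev p)" "successively (\<lambda>x y. {x, y} \<in> edges G) (rev p)"
    using assms(2) by (auto simp: path_inter_def in_paths_iff simp del: successively_rev)
  hence "x \<in> path_label R \<alpha> p"
    using path_label_rev[OF assms(1), of "rev p" x] by simp
  moreover have "ideal (path_label R \<alpha> p) R"
    using p ideal_path_label[OF assms(1)] by (auto simp: in_paths_iff)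
  ultimately show "\<ominus> x \<in> path_label R \<alpha> p"
    by (simp add: additive_subgroup.a_inv_closed ideal.axioms(1))
qed

section \<open>Differences of spline values\<close>

lemma minus_add_minus:
  assumes "a \<in> carrier R" "b \<in> carrier R" "c \<in> carrier R"
  shows "(a \<ominus> b) \<oplus> (b \<ominus> c) = a \<ominus> c"
  using assms by (simp add: minus_eq a_assoc r_neg1)

text \<open>The difference telescopes along the path, each summand lying in the ideal of its
  edge.\<close>

lemma spline_diff_in_path_label:
  assumes "spline R G \<alpha> \<rho>" "p \<in> paths G u w"
  shows "\<rho> u \<ominus> \<rho> w \<in> path_label R \<alpha> p"
proof -
  have carr: "\<rho> y \<in> carrier R" if "y \<in> verts G" for y
    using assms(1) that by (auto simp: spline_def)
  have "\<rho> (hd p) \<ominus> \<rho> (last p) \<in> path_label R \<alpha> p"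
    if "p \<noteq> []" "successively (\<lambda>x y. {x, y} \<in> edges G) p" "set p \<subseteq> verts G"
    using that
  proof (induction p rule: induct_list012)
    case (2 x)
    thus ?case using carr[of x] by (simp add: minus_eq r_neg)
  next
    case (3 x y p)
    have "\<rho> x \<ominus> \<rho> y \<in> \<alpha> {x, y}"
      using assms(1) "3.prems" by (auto simp: spline_def)
    moreover have "\<rho> y \<ominus> \<rho> (last (y # p)) \<in> path_label R \<alpha> (y # p)"
      using "3.IH"(2) "3.prems" by simp
    moreover have "x \<in> verts G" "y \<in> verts G" "last (y # p) \<in> verts G"
      using "3.prems"(3) last_in_set[of "y # p"] by auto
    ultimately have "\<rho> x \<ominus> \<rho> (last (y # p)) \<in> \<alpha> {x, y} <+>\<^bsub>R\<^esub> path_label R \<alpha> (y # p)"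
      using set_addI minus_add_minus[OF carr carr carr] by metis
    thus ?case by simp
  qed auto
  thus ?thesis
    using assms(2) by (auto simp: in_paths_iff)
qed

text \<open>The inclusion that holds for every labeling; \<open>UDP\<close> asks that all elements
  of the intersection arise in this way.\<close>

lemma spline_diff_in_path_inter:
  assumes "spline R G \<alpha> \<rho>" "u \<in> verts G" "w \<in> verts G"
  shows "\<rho> u \<ominus> \<rho> w \<in> path_inter R G \<alpha> u w"
  using assms spline_diff_in_path_label[OF assms(1)]
  by (auto simp: path_inter_def spline_def minus_closed)

lemma spline_add:
  assumes "spline R G \<alpha> \<rho>" "spline R G \<alpha> \<sigma>" "edge_labeling R G \<alpha>" "\<Union>(edges G) \<subseteq> verts G"
  shows "spline R G \<alpha> (\<lambda>y. \<rho> y \<oplus> \<sigma> y)"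
  unfolding spline_def
proof (intro conjI allI impI)
  show "(\<lambda>y. \<rho> y \<oplus> \<sigma> y) \<in> verts G \<rightarrow> carrier R"
    using assms(1,2) by (auto simp: spline_def)
  fix x y assume e: "{x, y} \<in> edges G"
  hence "x \<in> verts G" "y \<in> verts G"
    using assms(4) by auto
  hence carr: "\<rho> x \<in> carrier R" "\<rho> y \<in> carrier R" "\<sigma> x \<in> carrier R" "\<sigma> y \<in> carrier R"
    using assms(1,2) by (auto simp: spline_def)
  interpret ideal "\<alpha> {x, y}" R
    using e assms(3) by (auto simp: edge_labeling_def)
  have "(\<rho> x \<ominus> \<rho> y) \<oplus> (\<sigma> x \<ominus> \<sigma> y) \<in> \<alpha> {x, y}"
    using assms(1,2) e by (auto simp: spline_def)
  also have "(\<rho> x \<ominus> \<rho> y) \<oplus> (\<sigma> x \<ominus> \<sigma> y) = (\<rho> x \<oplus> \<sigma> x) \<ominus> (\<rho> y \<oplus> \<sigma> y)"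
    using carr by (simp add: minus_eq a_ac minus_add)
  finally show "(\<rho> x \<oplus> \<sigma> x) \<ominus> (\<rho> y \<oplus> \<sigma> y) \<in> \<alpha> {x, y}" .
qed

lemma spline_const:
  assumes "edge_labeling R G \<alpha>" "c \<in> carrier R"
  shows "spline R G \<alpha> (\<lambda>_. c)"
  unfolding spline_def
proof (intro conjI allI impI)
  fix x y assume "{x, y} \<in> edges G"
  then interpret ideal "\<alpha> {x, y}" R
    using assms(1) by (auto simp: edge_labeling_def)
  show "c \<ominus> c \<in> \<alpha> {x, y}"
    using assms(2) by (simp add: minus_eq r_neg)
qed (use assms(2) in auto)

section \<open>Trees\<close>

text \<open>The edge from \<open>u\<close> to \<open>v\<close> is a bridge, and the rest of the path
  keeps \<open>w\<close> on the side of \<open>v\<close>. A function constant on each side jumps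
  only across the bridge, by \<open>a\<close>.\<close>

lemma tree_edge_spline:
  assumes "tree T" "edge_labeling R T \<alpha>" "u # v # p \<in> paths T u w" "a \<in> \<alpha> {u, v}"
  obtains \<sigma> where "spline R T \<alpha> \<sigma>" "\<sigma> u = a" "\<sigma> v = \<zero>" "\<sigma> w = \<zero>"
proof
  define T' where "T' = T\<lparr>edges := edges T - {{u, v}}\<rparr>"
  \<comment> \<open>The component of \<open>u\<close> after deletion of the bridge.\<close>
  define S where "S = {y. paths T' u y \<noteq> {}}"
  let ?\<sigma> = "\<lambda>y. if y \<in> S then a else \<zero>"
  have wf: "\<Union>(edges T) \<subseteq> verts T"
    using assms(1) by (fastforce simp: tree_def simple_graph_def)
  have path: "{u, v} \<in> edges T" "u \<notin> set (v # p)" "u \<in> verts T" "w = last (v # p)"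
    "successively (\<lambda>x y. {x, y} \<in> edges T) (v # p)"
    using assms(3) by (auto simp: in_paths_iff)
  have id: "ideal (\<alpha> e) R" if "e \<in> edges T" for e
    using assms(2) that by (auto simp: edge_labeling_def)
  have a: "a \<in> carrier R"
    using id[OF path(1)] assms(4) by (rule ideal.Icarr)
  have "[u] \<in> paths T' u u"
    using path by (auto simp: in_paths_iff T'_def)
  hence u: "u \<in> S" unfolding S_def by blast
  have v: "v \<notin> S"
    using tree_edge_is_bridge[OF assms(1) path(1)] by (simp add: S_def T'_def)
  have S_edge: "y \<in> S" if "x \<in> S" "{x, y} \<in> edges T" "{x, y} \<noteq> {u, v}" for x y
    using that wf paths_extend_edge[of T' u x y] by (auto simp: S_def T'_def)
  have S_edge_iff: "x \<in> S \<longleftrightarrow> y \<in> S" if "{x, y} \<in> edges T" "{x, y} \<noteq> {u, v}" for x y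
    using S_edge[of x y] S_edge[of y x] that by (auto simp: insert_commute)
  \<comment> \<open>A walk that avoids \<open>u\<close> never uses the bridge, so it cannot enter
    \<open>S\<close>. This puts \<open>w\<close> outside \<open>S\<close>.\<close>
  have "last q \<notin> S" if "q \<noteq> []" "hd q \<notin> S" "u \<notin> set q" "successively (\<lambda>x y. {x, y} \<in> edges T) q" for q
    using that
  proof (induction q rule: induct_list012)
    case (3 x y q)
    have "{x, y} \<noteq> {u, v}"
      using "3.prems"(3) by (auto simp: doubleton_eq_iff)
    hence "y \<notin> S"
      using S_edge_iff[of x y] "3.prems" by auto
    thus ?case using 3 by auto
  qed auto
  from this[of "v # p"] have w: "w \<notin> S"
    using path v by simp
  show "?\<sigma> u = a" "?\<sigma> v = \<zero>" "?\<sigma> w = \<zero>"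
    using u v w by auto
  show "spline R T \<alpha> ?\<sigma>"
    unfolding spline_def
  proof (intro conjI allI impI)
    show "?\<sigma> \<in> verts T \<rightarrow> carrier R"
      using a by auto
    fix x y assume e: "{x, y} \<in> edges T"
    interpret ideal "\<alpha> {x, y}" R
      by (rule id[OF e])
    show "?\<sigma> x \<ominus> ?\<sigma> y \<in> \<alpha> {x, y}"
    \<comment> \<open>On the bridge the difference is \<open>a\<close> or its negative, depending on
      the orientation; on any other edge both ends are on the same side and it is zero.\<close>
    proof (cases "{x, y} = {u, v}")
      case True
      hence "a \<in> \<alpha> {x, y}"
        using assms(4) by simp
      moreover from this have "\<ominus> a \<in> \<alpha> {x, y}"
        by (rule a_inv_closed)
      moreover have "x = u \<and> y = v \<or> x = v \<and> y = u"
        using True by (simp add: doubleton_eq_iff)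
      ultimately show ?thesis
        using a u v by (auto simp: minus_eq)
    next
      case False
      thus ?thesis
        using S_edge_iff[OF e False] a by (auto simp: minus_eq r_neg)
    qed
  qed
qed

text \<open>Induction along the path, adding one edge in front: the spline for the tail is adjusted
  by a spline from \<open>tree_edge_spline\<close>.\<close>

lemma tree_path_label_spline:
  assumes "tree T" "edge_labeling R T \<alpha>" "p \<in> paths T u w" "x \<in> path_label R \<alpha> p"
  shows "\<exists>\<rho>. spline R T \<alpha> \<rho> \<and> \<rho> u \<ominus> \<rho> w = x"
  using assms(3,4)
proof (induction p arbitrary: u x rule: induct_list012)
  case 1
  thus ?case by (simp add: in_paths_iff)
next
  case (2 y)
  thus ?case
    using spline_const[OF assms(2), of \<zero>]
    by (intro exI[of _ "\<lambda>_. \<zero>"]) (auto simp: minus_eq)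
next
  case (3 u' v p)
  have "u' = u"
    using "3.prems"(1) by (simp add: in_paths_iff)
  note path = "3.prems"(1)[unfolded this]
  have wf: "\<Union>(edges T) \<subseteq> verts T"
    using assms(1) by (fastforce simp: tree_def simple_graph_def)
  obtain a b where ab: "a \<in> \<alpha> {u, v}" "b \<in> path_label R \<alpha> (v # p)" "x = a \<oplus> b"
    using "3.prems"(2) \<open>u' = u\<close> by (auto elim: set_addE)
  have "v # p \<in> paths T v w"
    using path by (auto simp: in_paths_iff)
  from "3.IH"(2)[OF this ab(2)] obtain \<rho>
    where \<rho>: "spline R T \<alpha> \<rho>" "\<rho> v \<ominus> \<rho> w = b" by blast
  have verts: "u \<in> verts T" "v \<in> verts T" "w \<in> verts T" and e: "{u, v} \<in> edges T"
    using path last_in_set[of "u # v # p"] by (auto simp: in_paths_iff)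
  hence carr: "\<rho> u \<in> carrier R" "\<rho> v \<in> carrier R" "\<rho> w \<in> carrier R"
    using \<rho>(1) by (auto simp: spline_def)
  interpret ideal "\<alpha> {u, v}" R
    using e assms(2) by (auto simp: edge_labeling_def)
  have a: "a \<in> carrier R"
    using ab(1) by (rule Icarr)
  \<comment> \<open>The tail only controls \<open>\<rho> v - \<rho> w\<close>; the jump across \<open>uv\<close> is corrected to exactly \<open>a\<close>.\<close>
  define c where "c = a \<ominus> (\<rho> u \<ominus> \<rho> v)"
  have "\<rho> u \<ominus> \<rho> v \<in> \<alpha> {u, v}"
    using \<rho>(1) e by (auto simp: spline_def)
  hence c: "c \<in> \<alpha> {u, v}"
    using ab(1) by (simp add: c_def minus_eq)
  \<comment> \<open>Since \<open>\<tau>\<close> vanishes at \<open>w\<close>, adding it changes the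
    difference between \<open>u\<close> and \<open>w\<close> by exactly \<open>c\<close>.\<close>
  obtain \<tau> where \<tau>: "spline R T \<alpha> \<tau>" "\<tau> u = c" "\<tau> v = \<zero>" "\<tau> w = \<zero>"
    using tree_edge_spline[OF assms(1,2) path c] by blast
  have "\<rho> u \<oplus> c = a \<oplus> (\<rho> u \<oplus> (\<ominus> \<rho> u \<oplus> \<rho> v))"
    using carr a by (simp add: c_def minus_eq minus_add a_lcomm)
  hence "(\<rho> u \<oplus> c) \<ominus> (\<rho> w \<oplus> \<zero>) = a \<oplus> (\<rho> v \<ominus> \<rho> w)"
    using carr a by (simp add: minus_eq a_assoc r_neg2)
  hence "(\<rho> u \<oplus> \<tau> u) \<ominus> (\<rho> w \<oplus> \<tau> w) = x"
    by (simp add: \<tau> ab(3) \<rho>(2))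
  thus ?case
    using spline_add[OF \<rho>(1) \<tau>(1) assms(2) wf] by blast
qed

text \<open>Connectedness supplies one path, and an element of the intersection lies in its label,
  which is enough to build the spline.\<close>

lemma UDP_tree:
  assumes "tree T" "edge_labeling R T \<alpha>"
  shows "UDP R T \<alpha>"
  unfolding UDP_def
proof (intro ballI)
  fix u w x assume "u \<in> verts T" "w \<in> verts T" and x: "x \<in> path_inter R T \<alpha> u w"
  then obtain p where "p \<in> paths T u w"
    using assms(1) unfolding tree_def connected_graph_def by blast
  thus "\<exists>\<rho>. spline R T \<alpha> \<rho> \<and> \<rho> u \<ominus> \<rho> w = x"
    using x tree_path_label_spline[OF assms] by (auto simp: path_inter_def)
qed

section \<open>Pasting\<close>

lemma UDP_pasting_left:
  assumes "pasting H T z G" "\<Union>(edges H) \<subseteq> verts H" "\<Union>(edges T) \<subseteq> verts T" "UDP R G \<alpha>"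
  shows "UDP R H \<alpha>"
  unfolding UDP_def
proof (intro ballI)
  fix u w x assume *: "u \<in> verts H" "w \<in> verts H" "x \<in> path_inter R H \<alpha> u w"
  have "x \<in> path_inter R G \<alpha> u w"
    using * by (simp add: pasting_path_inter_eq[OF assms(1-3)])
  then obtain \<rho> where "spline R G \<alpha> \<rho>" "\<rho> u \<ominus> \<rho> w = x"
    using assms(4) * pasting_verts[OF assms(1)] unfolding UDP_def by blast
  thus "\<exists>\<rho>. spline R H \<alpha> \<rho> \<and> \<rho> u \<ominus> \<rho> w = x"
    using spline_subset[of R G \<alpha> \<rho> H] pasting_verts[OF assms(1)] pasting_edges[OF assms(1)] by auto
qed

text \<open>Every path from \<open>u\<close> to \<open>w\<close> is cut at \<open>z\<close>; one
  summand lies in the label of each half.\<close>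

lemma path_inter_add_subset_pasting:
  assumes "pasting H T z G" "\<Union>(edges H) \<subseteq> verts H" "\<Union>(edges T) \<subseteq> verts T"
    and "edge_labeling R G \<alpha>" "u \<in> verts H" "w \<in> verts T"
  shows "path_inter R G \<alpha> u z <+>\<^bsub>R\<^esub> path_inter R G \<alpha> z w \<subseteq> path_inter R G \<alpha> u w"
proof
  note z = pasting_vertex[OF assms(1)]
  note T = assms(1)[unfolded pasting_commute[of H]]
  fix x assume "x \<in> path_inter R G \<alpha> u z <+>\<^bsub>R\<^esub> path_inter R G \<alpha> z w"
  then obtain a b where ab: "a \<in> path_inter R G \<alpha> u z" "b \<in> path_inter R G \<alpha> z w" "x = a \<oplus> b"
    by (auto elim: set_addE)
  show "x \<in> path_inter R G \<alpha> u w"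
    unfolding path_inter_def
  proof (intro IntI INT_I)
    show "x \<in> carrier R"
      using ab by (auto simp: path_inter_def)
    fix p assume p: "p \<in> paths G u w"
    obtain p1 p2 where p12: "p = p1 @ z # p2" "p1 @ [z] \<in> paths H u z" "z # p2 \<in> paths T z w"
      using pasting_path_crosses[OF assms(1-3) p assms(5,6)] .
    have "a \<in> path_label R \<alpha> (p1 @ [z])"
      using ab(1) p12(2) pasting_paths_eq[OF assms(1-3) assms(5) z(1)] by (auto simp: path_inter_def)
    moreover have "b \<in> path_label R \<alpha> (z # p2)"
      using ab(2) p12(3) pasting_paths_eq[OF T assms(3,2) z(2) assms(6)] by (auto simp: path_inter_def)
    ultimately show "x \<in> path_label R \<alpha> p"
      using path_label_append[OF assms(4)] p unfolding p12(1) ab(3) in_paths_iff by blast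
  qed
qed

text \<open>A spline realising \<open>x\<close> splits it through its value at
  \<open>z\<close>.\<close>

lemma path_inter_subset_add_of_UDP:
  assumes "UDP R G \<alpha>" "u \<in> verts G" "z \<in> verts G" "w \<in> verts G"
  shows "path_inter R G \<alpha> u w \<subseteq> path_inter R G \<alpha> u z <+>\<^bsub>R\<^esub> path_inter R G \<alpha> z w"
proof
  fix x assume "x \<in> path_inter R G \<alpha> u w"
  then obtain \<rho> where \<rho>: "spline R G \<alpha> \<rho>" "\<rho> u \<ominus> \<rho> w = x"
    using assms unfolding UDP_def by blast
  have "\<rho> u \<in> carrier R" "\<rho> z \<in> carrier R" "\<rho> w \<in> carrier R"
    using \<rho>(1) assms(2-4) by (auto simp: spline_def)
  hence "x = (\<rho> u \<ominus> \<rho> z) \<oplus> (\<rho> z \<ominus> \<rho> w)"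
    by (simp add: minus_add_minus \<rho>(2))
  thus "x \<in> path_inter R G \<alpha> u z <+>\<^bsub>R\<^esub> path_inter R G \<alpha> z w"
    using spline_diff_in_path_inter[OF \<rho>(1)] assms(2-4) by (auto intro: set_addI)
qed

text \<open>Shifting \<open>\<sigma>\<close> by a constant makes it agree with \<open>\<rho>\<close>
  at the common vertex and changes none of its differences. The conclusion therefore speaks of
  differences, not values.\<close>

lemma spline_glue:
  assumes "pasting H T z G" "\<Union>(edges H) \<subseteq> verts H" "\<Union>(edges T) \<subseteq> verts T"
    and "edge_labeling R G \<alpha>" "spline R H \<alpha> \<rho>" "spline R T \<alpha> \<sigma>"
  obtains \<tau> where "spline R G \<alpha> \<tau>"
    "\<And>x y. x \<in> verts H \<Longrightarrow> y \<in> verts H \<Longrightarrow> \<tau> x \<ominus> \<tau> y = \<rho> x \<ominus> \<rho> y"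
    "\<And>x y. x \<in> verts T \<Longrightarrow> y \<in> verts T \<Longrightarrow> \<tau> x \<ominus> \<tau> y = \<sigma> x \<ominus> \<sigma> y"
proof
  define d where "d = \<rho> z \<ominus> \<sigma> z"
  define \<tau> where "\<tau> = (\<lambda>y. if y \<in> verts H then \<rho> y else \<sigma> y \<oplus> d)"
  note z = pasting_vertex[OF assms(1)]
  have carr: "y \<in> verts H \<Longrightarrow> \<rho> y \<in> carrier R" "y \<in> verts T \<Longrightarrow> \<sigma> y \<in> carrier R" for y
    using assms(5,6) by (auto simp: spline_def)
  have d: "d \<in> carrier R"
    using carr z by (simp add: d_def)
  have \<tau>H: "\<tau> y = \<rho> y" if "y \<in> verts H" for y
    using that by (simp add: \<tau>_def)
  \<comment> \<open>The definition uses \<open>\<rho>\<close> at the shared vertex \<open>z\<close>;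
    the choice of \<open>d\<close> makes the formula for \<open>T\<close> valid there too.\<close>
  have \<tau>T: "\<tau> y = \<sigma> y \<oplus> d" if "y \<in> verts T" for y
  proof (cases "y \<in> verts H")
    case True
    hence "y = z" using that pasting_Int_verts[OF assms(1)] by auto
    thus ?thesis
      using z carr by (simp add: \<tau>_def d_def minus_eq a_lcomm r_neg)
  qed (simp add: \<tau>_def)
  show H: "\<tau> x \<ominus> \<tau> y = \<rho> x \<ominus> \<rho> y" if "x \<in> verts H" "y \<in> verts H" for x y
    using that \<tau>H by simp
  show T: "\<tau> x \<ominus> \<tau> y = \<sigma> x \<ominus> \<sigma> y" if "x \<in> verts T" "y \<in> verts T" for x y
  proof -
    note xy = carr(2)[OF that(1)] carr(2)[OF that(2)]
    have "\<tau> x \<ominus> \<tau> y = \<sigma> x \<oplus> (d \<oplus> (\<ominus> d \<oplus> \<ominus> \<sigma> y))"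
      using that \<tau>T xy d by (simp add: minus_eq minus_add a_assoc a_comm[of "\<ominus> \<sigma> y"])
    thus ?thesis
      using xy d by (simp add: minus_eq r_neg2)
  qed
  show "spline R G \<alpha> \<tau>"
    unfolding spline_def
  proof (intro conjI allI impI)
    show "\<tau> \<in> verts G \<rightarrow> carrier R"
      using carr \<tau>H \<tau>T d pasting_verts[OF assms(1)] by auto
    fix x y assume "{x, y} \<in> edges G"
    then consider "{x, y} \<in> edges H" | "{x, y} \<in> edges T"
      using pasting_edges[OF assms(1)] by auto
    thus "\<tau> x \<ominus> \<tau> y \<in> \<alpha> {x, y}"
    proof cases
      case 1
      hence "x \<in> verts H" "y \<in> verts H" using assms(2) by auto
      thus ?thesis using 1 H assms(5) by (auto simp: spline_def)
    next
      case 2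
      hence "x \<in> verts T" "y \<in> verts T" using assms(3) by auto
      thus ?thesis using 2 T assms(6) by (auto simp: spline_def)
    qed
  qed
qed

text \<open>For endpoints in different parts, \<open>split\<close> divides \<open>x\<close> into one
  summand for each part, and the two splines realising them are glued. For endpoints in one part, a
  spline on that part is extended to \<open>G\<close>.\<close>

lemma UDP_pasting:
  assumes "pasting H T z G" "\<Union>(edges H) \<subseteq> verts H" "\<Union>(edges T) \<subseteq> verts T"
    and "edge_labeling R G \<alpha>" "UDP R H \<alpha>" "UDP R T \<alpha>"
    and split: "\<And>u w. u \<in> verts H \<Longrightarrow> w \<in> verts T \<Longrightarrow>
      path_inter R G \<alpha> u w \<subseteq> path_inter R G \<alpha> u z <+>\<^bsub>R\<^esub> path_inter R G \<alpha> z w"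
  shows "UDP R G \<alpha>"
proof -
  note z = pasting_vertex[OF assms(1)]
  note T = assms(1)[unfolded pasting_commute[of H]]
  note interH = pasting_path_inter_eq[OF assms(1-3), where R = R and \<alpha> = \<alpha>]
  note interT = pasting_path_inter_eq[OF T assms(3,2), where R = R and \<alpha> = \<alpha>]
  have labH: "edge_labeling R H \<alpha>" and labT: "edge_labeling R T \<alpha>"
    using edge_labeling_subset[OF assms(4)] pasting_edges[OF assms(1)] by auto
  have across: "\<exists>\<tau>. spline R G \<alpha> \<tau> \<and> \<tau> u \<ominus> \<tau> w = x"
    if u: "u \<in> verts H" and w: "w \<in> verts T" and x: "x \<in> path_inter R G \<alpha> u w" for u w x
  proof -
    have "x \<in> path_inter R H \<alpha> u z <+>\<^bsub>R\<^esub> path_inter R T \<alpha> z w"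
      using x split[OF u w] interH[OF u z(1)] interT[OF z(2) w] by auto
    then obtain a b where ab: "a \<in> path_inter R H \<alpha> u z" "b \<in> path_inter R T \<alpha> z w" "x = a \<oplus> b"
      by (rule set_addE)
    obtain \<rho> where \<rho>: "spline R H \<alpha> \<rho>" "\<rho> u \<ominus> \<rho> z = a"
      using assms(5) ab(1) u z unfolding UDP_def by blast
    obtain \<sigma> where \<sigma>: "spline R T \<alpha> \<sigma>" "\<sigma> z \<ominus> \<sigma> w = b"
      using assms(6) ab(2) w z unfolding UDP_def by blast
    obtain \<tau> where \<tau>: "spline R G \<alpha> \<tau>" "\<tau> u \<ominus> \<tau> z = a" "\<tau> z \<ominus> \<tau> w = b"
      using spline_glue[OF assms(1-4) \<rho>(1) \<sigma>(1)] \<rho>(2) \<sigma>(2) u w z by metis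
    have "\<tau> u \<in> carrier R" "\<tau> z \<in> carrier R" "\<tau> w \<in> carrier R"
      using \<tau>(1) u w z pasting_verts[OF assms(1)] by (auto simp: spline_def)
    hence "\<tau> u \<ominus> \<tau> w = x"
      using minus_add_minus \<tau>(2,3) ab(3) by metis
    thus ?thesis using \<tau>(1) by blast
  qed
  show ?thesis
    unfolding UDP_def
  proof (intro ballI)
    fix u w x assume "u \<in> verts G" "w \<in> verts G" and x: "x \<in> path_inter R G \<alpha> u w"
    then consider "u \<in> verts H" "w \<in> verts H" | "u \<in> verts H" "w \<in> verts T"
      | "u \<in> verts T" "w \<in> verts H" | "u \<in> verts T" "w \<in> verts T"
      using pasting_verts[OF assms(1)] by auto
    thus "\<exists>\<tau>. spline R G \<alpha> \<tau> \<and> \<tau> u \<ominus> \<tau> w = x"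
    proof cases
      case 1
      then obtain \<rho> where \<rho>: "spline R H \<alpha> \<rho>" "\<rho> u \<ominus> \<rho> w = x"
        using assms(5) x interH unfolding UDP_def by blast
      \<comment> \<open>Gluing with the zero spline on the other part serves as extension to
        \<open>G\<close>.\<close>
      show ?thesis
        using spline_glue[OF assms(1-4) \<rho>(1) spline_const[OF labT zero_closed]] \<rho>(2) 1 by metis
    next
      case 2
      thus ?thesis using across x by blast
    next
      case 3
      obtain \<tau> where \<tau>: "spline R G \<alpha> \<tau>" "\<tau> w \<ominus> \<tau> u = \<ominus> x"
        using across[OF 3(2,1) path_inter_uminus[OF assms(4) x]] by blast
      have carr: "\<tau> u \<in> carrier R" "\<tau> w \<in> carrier R" "x \<in> carrier R"
        using \<tau>(1) 3 x pasting_verts[OF assms(1)] by (auto simp: spline_def path_inter_def)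
      have "\<tau> u \<ominus> \<tau> w = \<ominus> (\<tau> w \<ominus> \<tau> u)"
        using carr by (simp add: minus_eq minus_add a_comm)
      thus ?thesis
        using \<tau> carr by auto
    next
      case 4
      then obtain \<sigma> where \<sigma>: "spline R T \<alpha> \<sigma>" "\<sigma> u \<ominus> \<sigma> w = x"
        using assms(6) x interT unfolding UDP_def by blast
      show ?thesis
        using spline_glue[OF assms(1-4) spline_const[OF labH zero_closed] \<sigma>(1)] \<sigma>(2) 4 by metis
    qed
  qed
qed

text \<open>A single pasting step. The property of \<open>T\<close> is automatic by
  \<open>UDP_tree\<close>, so only that of \<open>H\<close> and the decomposition at
  \<open>z\<close> remain as conditions.\<close>

lemma UDP_pasting_tree_iff:
  assumes "pasting H T z G" "\<Union>(edges H) \<subseteq> verts H" "tree T" "edge_labeling R G \<alpha>"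
  shows "UDP R G \<alpha> \<longleftrightarrow> UDP R H \<alpha> \<and>
    (\<forall>u\<in>verts H. \<forall>w\<in>verts T.
       path_inter R G \<alpha> u w = path_inter R G \<alpha> u z <+>\<^bsub>R\<^esub> path_inter R G \<alpha> z w)"
proof -
  have wf: "\<Union>(edges T) \<subseteq> verts T"
    using assms(3) by (fastforce simp: tree_def simple_graph_def)
  have "edge_labeling R T \<alpha>"
    using edge_labeling_subset[OF assms(4)] pasting_edges[OF assms(1)] by auto
  hence T: "UDP R T \<alpha>"
    using assms(3) by (intro UDP_tree)
  show ?thesis
  proof (intro iffI conjI ballI)
    assume G: "UDP R G \<alpha>"
    show "UDP R H \<alpha>"
      using UDP_pasting_left[OF assms(1,2) wf G] .
    fix u w assume "u \<in> verts H" "w \<in> verts T"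
    thus "path_inter R G \<alpha> u w = path_inter R G \<alpha> u z <+>\<^bsub>R\<^esub> path_inter R G \<alpha> z w"
      using path_inter_subset_add_of_UDP[OF G, of u z w] pasting_vertex[OF assms(1)]
        path_inter_add_subset_pasting[OF assms(1,2) wf assms(4), of u w] pasting_verts[OF assms(1)]
      by auto
  next
    assume "UDP R H \<alpha> \<and> (\<forall>u\<in>verts H. \<forall>w\<in>verts T.
       path_inter R G \<alpha> u w = path_inter R G \<alpha> u z <+>\<^bsub>R\<^esub> path_inter R G \<alpha> z w)"
    thus "UDP R G \<alpha>"
      using UDP_pasting[OF assms(1,2) wf assms(4) _ T] by auto
  qed
qed

end

section \<open>Trees pasted onto a cycle\<close>

theorem theorem2p9:
  fixes R :: "('a, 'm) ring_scheme"
    and C :: "'v ugraph" and n :: nat and v :: "nat \<Rightarrow> 'v"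
    and T G :: "nat \<Rightarrow> 'v ugraph"
    and \<alpha> :: "'v set \<Rightarrow> 'a set"
  assumes "cring R"
    and "cycle_graph C" and "bij_betw v {1..n} (verts C)"
    and "\<And>i. i \<in> {1..n} \<Longrightarrow> tree (T i)"
    and "pasting C (T 1) (v 1) (G 1)"
    and "\<And>i. i \<in> {2..n} \<Longrightarrow> pasting (G (i - 1)) (T i) (v i) (G i)"
    and "edge_labeling R (G n) \<alpha>"
  shows "UDP R (G n) \<alpha> \<longleftrightarrow>
    (\<forall>j\<in>{1..n - 1}. UDP R (G j) \<alpha>) \<and>
    (\<forall>u\<in>verts (G (n - 1)). \<forall>w\<in>verts (T n).
       path_inter R (G n) \<alpha> u w =
         path_inter R (G n) \<alpha> u (v n) <+>\<^bsub>R\<^esub> path_inter R (G n) \<alpha> (v n) w)"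
proof -
  interpret cring R by fact
  obtain c where c: "distinct c" "length c \<ge> 3" "verts C = set c"
    "edges C = {{c ! i, c ! (Suc i mod length c)} | i. i < length c}"
    using assms(2) unfolding cycle_graph_def by blast
  have "n = card (verts C)"
    using bij_betw_same_card[OF assms(3)] by simp
  \<comment> \<open>Hence \<open>n - 1\<close> is at least 1, and the last pasting is onto
    \<open>G (n - 1)\<close> rather than onto the bare cycle.\<close>
  hence n: "n \<ge> 3"
    using c by (simp add: distinct_card)
  have "Suc i mod length c < length c" for i
    using c(2) by (intro mod_less_divisor) auto
  hence wfC: "\<Union>(edges C) \<subseteq> verts C"
    by (auto simp: c(3,4))
  have wfT: "\<Union>(edges (T i)) \<subseteq> verts (T i)" if "i \<in> {1..n}" for i
    using assms(4)[OF that] by (fastforce simp: tree_def simple_graph_def)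
  have wfG: "\<Union>(edges (G i)) \<subseteq> verts (G i)" if "1 \<le> i" "i \<le> n" for i
    using that
  proof (induction i rule: dec_induct)
    case base
    thus ?case
      using wfC wfT[of 1] n pasting_verts[OF assms(5)] pasting_edges[OF assms(5)] by auto
  next
    case (step i)
    have "pasting (G i) (T (Suc i)) (v (Suc i)) (G (Suc i))"
      using assms(6)[of "Suc i"] step by simp
    from pasting_verts[OF this] pasting_edges[OF this] show ?case
      using step wfT[of "Suc i"] by auto
  qed
  \<comment> \<open>The property passes from a pasted graph to the graph it extends, so it descends
    from \<open>G (n - 1)\<close> to all earlier stages by downward induction.\<close>
  have down: "UDP R (G j) \<alpha>" if "UDP R (G (n - 1)) \<alpha>" "j \<le> n - 1" "1 \<le> j" for j
    using that(2,3)
  proof (induction j rule: inc_induct)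
    case base
    show ?case by fact
  next
    case (step j)
    have "pasting (G j) (T (Suc j)) (v (Suc j)) (G (Suc j))"
      using assms(6)[of "Suc j"] step by simp
    moreover have "\<Union>(edges (G j)) \<subseteq> verts (G j)" "\<Union>(edges (T (Suc j))) \<subseteq> verts (T (Suc j))"
      using step.hyps step.prems by (intro wfG wfT; simp)+
    moreover have "UDP R (G (Suc j)) \<alpha>"
      using step.IH by simp
    ultimately show ?case
      by (rule UDP_pasting_left)
  qed
  \<comment> \<open>Condition (i) thus amounts to its instance \<open>j = n - 1\<close>, and the
    theorem reduces to the pasting of the last tree.\<close>
  have "UDP R (G (n - 1)) \<alpha> \<longleftrightarrow> (\<forall>j\<in>{1..n - 1}. UDP R (G j) \<alpha>)"
    using down n by auto
  moreover have "pasting (G (n - 1)) (T n) (v n) (G n)" "tree (T n)"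
    using n assms(4,6) by auto
  ultimately show ?thesis
    using UDP_pasting_tree_iff[of "G (n - 1)" "T n" "v n" "G n" \<alpha>] wfG[of "n - 1"] n assms(7)
    by simp
qed

end
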